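(* Let $(a_n)_{n \geq 0}$ be a sequence of complex numbers such that for some integers $s,d \geq 0$ and complex numbers $h_0,\dots,h_s$ its generating series satisfies, as formal power series, $$\sum_{n \geq 0} a_n t^n = \frac{h_0 + h_1 t + \cdots + h_s t^s}{(1-t)^d}.$$ Then for every integer $r \geq 1$ we have $$\sum_{n \geq 0} a_{nr} t^n = \frac{h_0^{\langle r \rangle} + h_1^{\langle r \rangle} t + \cdots + h_m^{\langle r \rangle} t^m}{(1-t)^{d}},$$ where $m := \max(s,d)$ and $$h_i^{\langle r \rangle} = \sum_{j=0}^s C(r-1,d,ir-j)\, h_j \qquad \text{for } i = 0,\ldots,m.$$
   Context: For integers $r \geq 0$, $d \geq 1$ and $i \ge 0$, $C(r,d,i)$ denotes the number of tuples $(a_1,\ldots,a_d)$ of nonnegative integers with $a_1+\cdots+a_d = i$ and $a_j \leq r$ for all $1 \leq j \leq d$. For $d=0$, $C(r,0,i) = \delta_{0,i}$ (equal to $1$ if $i=0$ and $0$ otherwise). For $i<0$, $C(r,d,i)=0$. *)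

theory Defs
  imports Complex_Main "HOL-Computational_Algebra.Formal_Power_Series"
begin

text \<open>Tuples are lists of length \<open>d\<close>. The index \<open>i\<close> is an integer because the
  theorem uses indices that may be negative; the count is then \<open>0\<close>.\<close>

definition C :: "nat \<Rightarrow> nat \<Rightarrow> int \<Rightarrow> nat" where
  "C r d i = card {as :: nat list. length as = d \<and> int (sum_list as) = i \<and> (\<forall>a\<in>set as. a \<le> r)}"

lemma C_0: "C r 0 i = (if i = 0 then 1 else 0)"
proof -
  have "{as :: nat list. length as = 0 \<and> int (sum_list as) = i \<and> (\<forall>a\<in>set as. a \<le> r)}
      = (if i = 0 then {[]} else {})"
    by auto
  then show ?thesis
    by (simp add: C_def)
qed

lemma C_neg: "i < 0 \<Longrightarrow> C r d i = 0"
proof -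
  assume "i < 0"
  then have "{as :: nat list. length as = d \<and> int (sum_list as) = i \<and> (\<forall>a\<in>set as. a \<le> r)} = {}"
    by auto
  then show ?thesis
    by (simp only: C_def card.empty)
qed

text \<open>The set of tuples is finite, so \<open>card\<close> is a genuine count.\<close>

lemma finite_C: "finite {as :: nat list. length as = d \<and> int (sum_list as) = i \<and> (\<forall>a\<in>set as. a \<le> r)}"
  by (rule finite_subset[OF _ finite_lists_length_eq[of "{..r}" d]]) auto

end

theory Submission
  imports Defs
begin

text \<open>
  Let \<open>P = 1 + X + \<dots> + X\<^sup>r\<^sup>-\<^sup>1\<close>, so that \<open>(1 - X) P = 1 - X\<^sup>r\<close>. If \<open>A (1 - X)\<^sup>d = H\<close>, then
  multiplying by \<open>P\<^sup>d\<close> gives \<open>A (1 - X\<^sup>r)\<^sup>d = P\<^sup>d H\<close>. Now keep only the coefficients whose index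
  is a multiple of \<open>r\<close>. This operation is linear over power series in \<open>X\<^sup>r\<close>
  (\<open>fps_decimate_mult_one_minus_X_power\<close> is the case needed here), so the left side becomes
  \<open>(\<Sum>n. a\<^bsub>nr\<^esub> X\<^sup>n) (1 - X)\<^sup>d\<close>. Since \<open>P\<^sup>d\<close> is the generating polynomial of the bounded tuples
  counted by \<open>C (r - 1) d\<close> (\<open>geometric_power_nth\<close>), the right side becomes the series with
  coefficients \<open>\<Sum>j\<le>s. C (r - 1) d (i r - j) h\<^sub>j\<close>. It stops at \<open>max s d\<close>: a tuple of \<open>d\<close> entries
  at most \<open>r - 1\<close> has sum at most \<open>d (r - 1)\<close>, and \<open>i r - j \<le> d (r - 1)\<close> with \<open>j \<le> s\<close> gives
  \<open>i r \<le> s + d (r - 1) \<le> r (max s d)\<close>.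
\<close>

definition fps_decimate :: "nat \<Rightarrow> 'a::zero fps \<Rightarrow> 'a fps" where
  "fps_decimate r f = Abs_fps (\<lambda>n. fps_nth f (n * r))"

lemma fps_decimate_nth [simp]: "fps_nth (fps_decimate r f) n = fps_nth f (n * r)"
  by (simp add: fps_decimate_def)

lemma fps_decimate_mult_one_minus_X:
  fixes f :: "'a::comm_ring_1 fps"
  assumes "r \<ge> 1"
  shows "fps_decimate r (f * (1 - fps_X ^ r)) = fps_decimate r f * (1 - fps_X)"
proof (rule fps_ext)
  fix n
  show "fps_nth (fps_decimate r (f * (1 - fps_X ^ r))) n
      = fps_nth (fps_decimate r f * (1 - fps_X)) n"
    using assms
    by (cases n) (simp_all add: right_diff_distrib fps_X_power_mult_right_nth)
qed

lemma fps_decimate_mult_one_minus_X_power: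
  fixes f :: "'a::comm_ring_1 fps"
  assumes "r \<ge> 1"
  shows "fps_decimate r (f * (1 - fps_X ^ r) ^ d) = fps_decimate r f * (1 - fps_X) ^ d"
proof (induction d)
  case (Suc d)
  have "fps_decimate r (f * (1 - fps_X ^ r) ^ Suc d)
      = fps_decimate r (f * (1 - fps_X ^ r) ^ d * (1 - fps_X ^ r))"
    by (simp add: mult_ac)
  also have "\<dots> = fps_decimate r (f * (1 - fps_X ^ r) ^ d) * (1 - fps_X)"
    by (rule fps_decimate_mult_one_minus_X[OF assms])
  finally show ?case
    by (simp add: Suc.IH mult_ac)
qed simp

text \<open>Expanding the power into a sum over all tuples of exponents, each tuple contributes \<open>1\<close>
  or \<open>0\<close> according to whether all of its entries respect the bound.\<close>

lemma geometric_power_nth: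
  "fps_nth ((\<Sum>i\<le>r. fps_X ^ i :: 'a::comm_ring_1 fps) ^ d) n = of_nat (C r d (int n))"
proof -
  have coeff: "fps_nth (\<Sum>i\<le>r. fps_X ^ i :: 'a fps) k = of_bool (k \<le> r)" for k
    by (simp add: fps_sum_nth fps_X_power_nth)
  have prod: "(\<Prod>k<d. of_bool (as ! k \<le> r)) = (of_bool (\<forall>x\<in>set as. x \<le> r) :: 'a)"
    if "length as = d" for as
  proof (cases "\<forall>x\<in>set as. x \<le> r")
    case True
    then show ?thesis
      using that by simp
  next
    case False
    then have "\<exists>k<d. \<not> as ! k \<le> r"
      unfolding all_set_conv_all_nth that by blast
    then obtain k where "k < d" "\<not> as ! k \<le> r"
      by blast
    then have "(\<Prod>k<d. of_bool (as ! k \<le> r)) = (0 :: 'a)"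
      by (intro prod_zero) auto
    then show ?thesis
      using False by simp
  qed
  have "fps_nth ((\<Sum>i\<le>r. fps_X ^ i :: 'a fps) ^ d) n
      = (\<Sum>as\<in>natpermute n d. \<Prod>k<d. of_bool (as ! k \<le> r))"
  proof (cases d)
    case 0
    then show ?thesis
      by (simp add: natpermute_0)
  next
    case (Suc m)
    then show ?thesis
      by (simp only: fps_power_nth_Suc coeff lessThan_Suc_atMost flip: atMost_atLeast0 Suc_eq_plus1)
  qed
  also have "\<dots> = (\<Sum>as\<in>natpermute n d. of_bool (\<forall>x\<in>set as. x \<le> r))"
    by (intro sum.cong refl prod) (simp add: natpermute_def)
  also have "\<dots> = of_nat (card (natpermute n d \<inter> {as. \<forall>x\<in>set as. x \<le> r}))"
    by (simp add: of_bool_def sum.If_cases natpermute_finite)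
  also have "natpermute n d \<inter> {as. \<forall>x\<in>set as. x \<le> r}
      = {as. length as = d \<and> int (sum_list as) = int n \<and> (\<forall>x\<in>set as. x \<le> r)}"
    by (auto simp: natpermute_def)
  finally show ?thesis
    by (simp add: C_def)
qed

lemma C_eq_0_of_large:
  assumes "i > int (d * r)"
  shows "C r d i = 0"
proof -
  have bound: "sum_list as \<le> d * r" if "length as = d" "\<forall>x\<in>set as. x \<le> r" for as :: "nat list"
    using that sum_list_mono[of as "\<lambda>x. x" "\<lambda>_. r"] by (simp add: sum_list_triv)
  have "int (sum_list as) \<noteq> i" if "length as = d" "\<forall>x\<in>set as. x \<le> r" for as :: "nat list"
    using bound[OF that] assms by linarith
  then have "{as :: nat list. length as = d \<and> int (sum_list as) = i \<and> (\<forall>x\<in>set as. x \<le> r)} = {}"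
    by blast
  then show ?thesis
    by (simp only: C_def card.empty)
qed

lemma C_decimated_eq_0_of_large:
  assumes "r \<ge> 1" "i > max s d" "j \<le> s"
  shows "C (r - 1) d (int (i * r) - int j) = 0"
proof (rule C_eq_0_of_large)
  obtain q where q: "r = Suc q"
    using assms(1) by (cases r) auto
  have "d * q \<le> i * q"
    using assms(2) by (intro mult_right_mono) auto
  moreover have "j < i"
    using assms(2,3) by simp
  ultimately have "d * q + j < i * r"
    unfolding q mult_Suc_right by linarith
  then show "int (d * (r - 1)) < int (i * r) - int j"
    unfolding q by (simp del: of_nat_mult)
qed

lemma geometric_power_mult_polynomial_nth:
  fixes h :: "nat \<Rightarrow> 'a::comm_ring_1"
  shows "fps_nth ((\<Sum>i\<le>r. fps_X ^ i) ^ d * (\<Sum>j=0..s. fps_const (h j) * fps_X ^ j)) n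
    = (\<Sum>j=0..s. of_nat (C r d (int n - int j)) * h j)"
proof -
  have "fps_nth ((\<Sum>i\<le>r. fps_X ^ i) ^ d * (fps_const c * fps_X ^ j)) n
      = c * of_nat (C r d (int n - int j))" for c :: 'a and j
  proof -
    have assoc: "(\<Sum>i\<le>r. fps_X ^ i) ^ d * (fps_const c * fps_X ^ j)
        = fps_const c * ((\<Sum>i\<le>r. fps_X ^ i) ^ d * fps_X ^ j)"
      by (simp add: mult_ac)
    show ?thesis
      unfolding assoc fps_mult_left_const_nth
      by (simp add: fps_X_power_mult_right_nth geometric_power_nth C_neg of_nat_diff)
  qed
  then show ?thesis
    by (simp add: sum_distrib_left fps_sum_nth mult.commute)
qed

lemma fps_eq_polynomial_of_nth_eq_0:
  fixes f :: "'a::comm_ring_1 fps"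
  assumes "\<And>i. i > m \<Longrightarrow> fps_nth f i = 0"
  shows "f = (\<Sum>i=0..m. fps_const (fps_nth f i) * fps_X ^ i)"
proof (rule fps_ext)
  fix n
  show "fps_nth f n = fps_nth (\<Sum>i=0..m. fps_const (fps_nth f i) * fps_X ^ i) n"
    using assms[of n] by (cases "n \<le> m") (simp_all add: fps_sum_nth fps_X_power_nth if_distrib cong: if_cong)
qed

theorem theorem1p1:
  fixes a h :: "nat \<Rightarrow> complex" and s d r :: nat
  assumes gen: "Abs_fps a = (\<Sum>j=0..s. fps_const (h j) * fps_X ^ j) / (1 - fps_X) ^ d"
    and r: "r \<ge> 1"
  shows "Abs_fps (\<lambda>n. a (n * r)) =
    (\<Sum>i=0..max s d. fps_const (\<Sum>j=0..s. of_nat (C (r - 1) d (int (i * r) - int j)) * h j) * fps_X ^ i)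
      / (1 - fps_X) ^ d"
proof -
  define H where "H = (\<Sum>j=0..s. fps_const (h j) * fps_X ^ j)"
  define P :: "complex fps" where "P = (\<Sum>i\<le>r - 1. fps_X ^ i)"
  have unit: "is_unit ((1 - fps_X :: complex fps) ^ d)"
    by (simp add: is_unit_power_iff)
  have H: "Abs_fps a * (1 - fps_X) ^ d = H"
    using gen unit by (simp add: H_def)
  have "{..r - 1} = {..<r}"
    using r by auto
  then have P: "1 - fps_X ^ r = (1 - fps_X) * P"
    by (simp add: P_def one_diff_power_eq)
  have "Abs_fps a * (1 - fps_X ^ r) ^ d = P ^ d * H"
    by (simp add: H[symmetric] P power_mult_distrib mult_ac)
  then have "fps_decimate r (Abs_fps a) * (1 - fps_X) ^ d = fps_decimate r (P ^ d * H)"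
    using fps_decimate_mult_one_minus_X_power[OF r, of "Abs_fps a" d] by simp
  moreover have coeff: "fps_nth (fps_decimate r (P ^ d * H)) i
      = (\<Sum>j=0..s. of_nat (C (r - 1) d (int (i * r) - int j)) * h j)" for i
    unfolding P_def H_def fps_decimate_nth by (rule geometric_power_mult_polynomial_nth)
  moreover have "fps_decimate r (P ^ d * H)
      = (\<Sum>i=0..max s d. fps_const (fps_nth (fps_decimate r (P ^ d * H)) i) * fps_X ^ i)"
  proof (rule fps_eq_polynomial_of_nth_eq_0)
    fix i assume "i > max s d"
    then show "fps_nth (fps_decimate r (P ^ d * H)) i = 0"
      unfolding coeff by (intro sum.neutral ballI) (subst C_decimated_eq_0_of_large[OF r], auto)
  qed
  ultimately have "fps_decimate r (Abs_fps a) * (1 - fps_X) ^ d = (\<Sum>i=0..max s d.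
      fps_const (\<Sum>j=0..s. of_nat (C (r - 1) d (int (i * r) - int j)) * h j) * fps_X ^ i)"
    by (simp only:)
  then have "fps_decimate r (Abs_fps a) = (\<Sum>i=0..max s d.
      fps_const (\<Sum>j=0..s. of_nat (C (r - 1) d (int (i * r) - int j)) * h j) * fps_X ^ i)
        / (1 - fps_X) ^ d"
    using unit by (metis nonzero_mult_div_cancel_right not_is_unit_0)
  then show ?thesis
    by (simp add: fps_decimate_def)
qed

end
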